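(* Let $G_l=\{(\mathbf v_{l,i},g_{l,i})\}_{i=1}^{m_l}$ be a group of stochastic particles with velocities $\mathbf v_{l,i}\in\mathbb R^3$ and weights $g_{l,i}>0$, with total weight $\varrho_l$, drift velocity $\mathbf V_l$, pressure tensor $P_l$ and central heat flux $\mathbf q_l$. Suppose that $P_l$ has exactly $k$ non-zero eigenvalues (counted with multiplicity) $\lambda_1,\dots,\lambda_k$ for some $k\in\{1,2,3\}$, with an associated orthonormal set of eigenvectors $\mathbf\Theta_1,\dots,\mathbf\Theta_k$ ($P_l\mathbf\Theta_i=\lambda_i\mathbf\Theta_i$), where the direction of each $\mathbf\Theta_i$ is chosen so that $\widehat q_{l,i}:=\mathbf\Theta_i^T\mathbf q_l>0$. Define, for $i=1,\dots,k$, $$\gamma_i=\frac{\sqrt{\varrho_l}\,\widehat q_{l,i}}{\sqrt{k}\,\lambda_i^{3/2}}+\sqrt{1+\frac{\varrho_l\,\widehat q_{l,i}^{\,2}}{k\,\lambda_i^3}},$$ and let $\widetilde G_l=\{(\widetilde{\mathbf v}_i,\widetilde g_i)\}_{i=1}^{2k}$ be the reduced group of $2k$ stochastic particles whose velocities and weights are given, for $i=1,\dots,k$, by $$\widetilde{\mathbf v}_i=\mathbf V_l+\gamma_i\sqrt{\frac{k\lambda_i}{\varrho_l}}\,\mathbf\Theta_i,\qquad \widetilde g_i=\frac{\varrho_l}{k}\,\frac{1}{1+\gamma_i^2},$$ $$\widetilde{\mathbf v}_{i+k}=\mathbf V_l-\frac1{\gamma_i}\sqrt{\frac{k\lambda_i}{\varrho_l}}\,\mathbf\Theta_i,\qquad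 \widetilde g_{i+k}=\frac{\varrho_l}{k}\,\frac{\gamma_i^2}{1+\gamma_i^2}.$$ Then $\widetilde G_l$ preserves the total weight, momentum, pressure tensor and central heat flux of $G_l$ (that is, each of these quantities, computed for $\widetilde G_l$, equals the corresponding quantity for $G_l$). Consequently, $\widetilde G_l$ preserves all the moments of $G_l$ up to second order (total weight, momentum, momentum flux tensor, pressure tensor) as well as the raw and central heat flux of $G_l$.
   Context: A stochastic particle is a pair $(\mathbf v,g)$ consisting of a velocity $\mathbf v\in\mathbb R^3$ and a positive weight $g$. For a finite group $G=\{(\mathbf v_i,g_i)\}_{i=1}^m$ of stochastic particles define: - total weight $\varrho=\sum_{i=1}^m g_i$; - momentum $\varrho\,\mathbf V=\sum_{i=1}^m g_i\mathbf v_i$, which defines the drift velocity $\mathbf V\in\mathbb R^3$; - momentum flux tensor $\Pi=\sum_{i=1}^m g_i\,\mathbf v_i\mathbf v_i^T$; - pressure tensor $P=\sum_{i=1}^m g_i(\mathbf v_i-\mathbf V)(\mathbf v_i-\mathbf V)^T$, a real symmetric positive semi-definite $3\times3$ matrix; - raw heat flux $\mathbf h=\frac12\sum_{i=1}^m g_i\,\mathbf v_i|\mathbf v_i|^2$; - central heat flux $\mathbf q=\frac12\sum_{i=1}^m g_i(\mathbf v_i-\mathbf V)|\mathbf v_i-\mathbf V|^2$. Here $|\cdot|$ is the Euclidean norm. A subscript $l$ (as in $\varrho_l,\mathbf V_l,\Pi_l,P_l,\mathbf h_l,\mathbf q_l$) denotes these quantities for the group $G_l$. *)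

theory Defs
  imports "HOL-Analysis.Analysis" "HOL-Computational_Algebra.Polynomial"
begin

text \<open>
  A group of \<open>m\<close> stochastic particles is given by velocities \<open>v 1, \<dots>, v m\<close> and weights
  \<open>g 1, \<dots>, g m\<close>; the values of \<open>v\<close> and \<open>g\<close> outside \<open>{1..m}\<close> are irrelevant.
\<close>

definition stochastic_group :: "nat \<Rightarrow> (nat \<Rightarrow> real ^ 3) \<Rightarrow> (nat \<Rightarrow> real) \<Rightarrow> bool" where
  "stochastic_group m v g \<longleftrightarrow> (\<forall>i\<in>{1..m}. 0 < g i)"

definition outer :: "real ^ 'n \<Rightarrow> real ^ 'n \<Rightarrow> real ^ 'n ^ 'n" where
  "outer x y = (\<chi> a b. x $ a * y $ b)"

definition total_weight :: "nat \<Rightarrow> (nat \<Rightarrow> real) \<Rightarrow> real" where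
  "total_weight m g = (\<Sum>i=1..m. g i)"

definition momentum :: "nat \<Rightarrow> (nat \<Rightarrow> real ^ 3) \<Rightarrow> (nat \<Rightarrow> real) \<Rightarrow> real ^ 3" where
  "momentum m v g = (\<Sum>i=1..m. g i *\<^sub>R v i)"

definition drift_velocity :: "nat \<Rightarrow> (nat \<Rightarrow> real ^ 3) \<Rightarrow> (nat \<Rightarrow> real) \<Rightarrow> real ^ 3" where
  "drift_velocity m v g = (1 / total_weight m g) *\<^sub>R momentum m v g"

definition momentum_flux :: "nat \<Rightarrow> (nat \<Rightarrow> real ^ 3) \<Rightarrow> (nat \<Rightarrow> real) \<Rightarrow> real ^ 3 ^ 3" where
  "momentum_flux m v g = (\<Sum>i=1..m. g i *\<^sub>R outer (v i) (v i))"

definition pressure_tensor :: "nat \<Rightarrow> (nat \<Rightarrow> real ^ 3) \<Rightarrow> (nat \<Rightarrow> real) \<Rightarrow> real ^ 3 ^ 3" where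
  "pressure_tensor m v g =
     (\<Sum>i=1..m. g i *\<^sub>R outer (v i - drift_velocity m v g) (v i - drift_velocity m v g))"

definition raw_heat_flux :: "nat \<Rightarrow> (nat \<Rightarrow> real ^ 3) \<Rightarrow> (nat \<Rightarrow> real) \<Rightarrow> real ^ 3" where
  "raw_heat_flux m v g = (1 / 2) *\<^sub>R (\<Sum>i=1..m. (g i * (norm (v i))\<^sup>2) *\<^sub>R v i)"

definition central_heat_flux :: "nat \<Rightarrow> (nat \<Rightarrow> real ^ 3) \<Rightarrow> (nat \<Rightarrow> real) \<Rightarrow> real ^ 3" where
  "central_heat_flux m v g =
     (1 / 2) *\<^sub>R (\<Sum>i=1..m. (g i * (norm (v i - drift_velocity m v g))\<^sup>2) *\<^sub>R (v i - drift_velocity m v g))"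

definition charpoly :: "real ^ 'n ^ 'n \<Rightarrow> real poly" where
  "charpoly A = det (\<chi> a b. (if a = b then [:0, 1:] else 0) - [:A $ a $ b:])"

text \<open>
  For a symmetric matrix all eigenvalues are real, so the real roots of the characteristic
  polynomial, with multiplicity, are all the eigenvalues.
\<close>

definition eigenvalues :: "real ^ 'n ^ 'n \<Rightarrow> real multiset" where
  "eigenvalues A = proots (charpoly A)"

end

theory Submission
  imports Defs
begin

text \<open>
  The theorem rests on two facts about the original group. First, its pressure tensor is
  \<open>P = \<Sum>i. \<lambda>\<^sub>i \<Theta>\<^sub>i \<Theta>\<^sub>i\<^sup>T\<close>: the \<open>\<lambda>\<^sub>i\<close> exhaust the non-zero eigenvalues, counted with multiplicity as
  roots of the characteristic polynomial (\<open>symmetric_eq_sum_outer_eigenvectors\<close>). Second, its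
  central heat flux lies in the range of \<open>P\<close>, because all weights are positive and so every
  peculiar velocity \<open>v\<^sub>i - V\<close> is orthogonal to the kernel of \<open>P\<close>; hence
  \<open>q = \<Sum>i. (\<Theta>\<^sub>i \<bullet> q) \<Theta>\<^sub>i\<close> (\<open>central_heat_flux_eigenvector_expansion\<close>).

  Both tensors thus split along the orthonormal directions \<open>\<Theta>\<^sub>i\<close>, and it suffices to solve one scalar
  problem for each direction: two particles on a line with weight \<open>\<rho> / k\<close>, mean zero, second
  moment \<open>\<lambda>\<^sub>i\<close> and third moment \<open>2 (\<Theta>\<^sub>i \<bullet> q)\<close>. The given \<open>\<gamma>\<^sub>i\<close> solves it
  (\<open>two_particle_moments\<close>). The momentum, the momentum flux and the raw heat flux are functions of the total
  weight, drift velocity, pressure tensor and central heat flux, so they are preserved as well.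

  The algebraic multiplicity enters through deflation. If \<open>A e = \<mu> e\<close> with \<open>e\<close> a unit vector, then
  \<open>X \<cdot> \<chi>(A) = (X - \<mu>) \<cdot> \<chi>(A - \<mu> e e\<^sup>T)\<close>, so subtracting \<open>\<mu> e e\<^sup>T\<close> removes exactly one copy of \<open>\<mu>\<close> from
  the non-zero spectrum. After all \<open>\<lambda>\<^sub>i \<Theta>\<^sub>i \<Theta>\<^sub>i\<^sup>T\<close> have been subtracted from \<open>P\<close>, the remainder is
  symmetric and has no non-zero eigenvalue, and by the maximum of the Rayleigh quotient it is \<open>0\<close>.
\<close>

section \<open>Rank-one tensors\<close>

lemma outer_mult_vec: "outer x y *v z = (y \<bullet> z) *\<^sub>R x"
  by (simp add: outer_def matrix_vector_mult_def vec_eq_iff inner_vec_def sum_distrib_left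
      sum_distrib_right mult_ac)

lemma matrix_vector_mult_sum_left:
  fixes A :: "'i \<Rightarrow> real ^ 'n ^ 'm"
  shows "(\<Sum>i\<in>I. A i) *v x = (\<Sum>i\<in>I. A i *v x)"
  by (induction I rule: infinite_finite_induct) (simp_all add: matrix_vector_mult_add_rdistrib)

lemma scaleR_outer_sum_mult_vec:
  fixes w :: "'i \<Rightarrow> real ^ 'n"
  shows "(\<Sum>i\<in>I. c i *\<^sub>R outer (w i) (w i)) *v x = (\<Sum>i\<in>I. (c i * (w i \<bullet> x)) *\<^sub>R w i)"
  by (simp add: matrix_vector_mult_sum_left scaleR_matrix_vector_assoc[symmetric] outer_mult_vec)

lemma transpose_outer_sum:
  fixes w :: "'i \<Rightarrow> real ^ 'n"
  shows "transpose (\<Sum>i\<in>I. c i *\<^sub>R outer (w i) (w i)) = (\<Sum>i\<in>I. c i *\<^sub>R outer (w i) (w i))"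
  by (simp add: vec_eq_iff transpose_def outer_def mult.commute)

lemma outer_add_add:
  "outer (x + y) (x + y) = outer x x + outer x y + outer y x + outer y y"
  by (simp add: outer_def vec_eq_iff algebra_simps)

section \<open>Symmetric matrices without non-zero eigenvalues\<close>

lemma inner_symmetric_matrix:
  fixes A :: "real ^ 'n ^ 'n"
  assumes "transpose A = A"
  shows "x \<bullet> (A *v y) = y \<bullet> (A *v x)"
  by (metis assms dot_lmul_matrix inner_commute transpose_matrix_vector)

text \<open>The quadratic function \<open>t \<mapsto> (x + t y) \<bullet> B (x + t y) = 2 t (y \<bullet> B x) + t\<^sup>2 (y \<bullet> B y)\<close> has a minimum
  at \<open>t = 0\<close>, so its linear coefficient vanishes; take \<open>y = B x\<close>.\<close>

lemma psd_isotropic_imp_kernel: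
  fixes B :: "real ^ 'n ^ 'n"
  assumes sym: "transpose B = B" and psd: "\<And>y. 0 \<le> y \<bullet> (B *v y)" and x: "x \<bullet> (B *v x) = 0"
  shows "B *v x = 0"
proof -
  define y where "y = B *v x"
  define a b where "a = y \<bullet> y" and "b = y \<bullet> (B *v y)"
  have b: "0 \<le> b" using psd by (simp add: b_def)
  have expand: "(x + t *\<^sub>R y) \<bullet> (B *v (x + t *\<^sub>R y)) = 2 * t * a + t\<^sup>2 * b" for t
    using x inner_symmetric_matrix[OF sym, of x y]
    by (simp add: a_def b_def y_def[symmetric] inner_simps matrix_vector_right_distrib
        matrix_vector_mult_scaleR power2_eq_square)
       (simp add: algebra_simps)
  \<comment> \<open>The vertex of the parabola is at \<open>- a / b\<close>; the shifted denominator also covers \<open>b = 0\<close>.\<close>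
  have "0 \<le> 2 * (- a / (b + 1)) * a + (- a / (b + 1))\<^sup>2 * b"
    using psd[of "x + (- a / (b + 1)) *\<^sub>R y"] unfolding expand .
  also have "\<dots> = - (a\<^sup>2 * (b + 2)) / (b + 1)\<^sup>2"
    using b by (simp add: divide_simps power2_eq_square) (simp add: algebra_simps)
  finally have "a\<^sup>2 * (b + 2) \<le> 0"
    using b by (simp add: divide_simps split: if_splits)
  then have "a = 0"
    using b by (simp add: mult_le_0_iff)
  then show ?thesis by (simp add: a_def y_def)
qed

text \<open>If the quadratic form of \<open>A\<close> attains its maximum \<open>\<mu>\<close> on the unit sphere at \<open>x\<close>, then
  \<open>\<mu> I - A\<close> is positive semi-definite and its quadratic form vanishes at \<open>x\<close>.\<close>

lemma symmetric_max_eigenvalue: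
  fixes A :: "real ^ 'n ^ 'n"
  assumes sym: "transpose A = A"
  obtains \<mu> x where "norm x = 1" "A *v x = \<mu> *\<^sub>R x" "\<And>y. y \<bullet> (A *v y) \<le> \<mu> * (y \<bullet> y)"
proof -
  have ne: "sphere (0 :: real ^ 'n) 1 \<noteq> {}" by simp
  have cont: "continuous_on (sphere 0 1) (\<lambda>x. x \<bullet> (A *v x))"
    by (intro continuous_intros linear_continuous_on matrix_vector_mul_bounded_linear)
  obtain x where nx: "norm x = 1" and sup: "\<And>y. norm y = 1 \<Longrightarrow> y \<bullet> (A *v y) \<le> x \<bullet> (A *v x)"
    using continuous_attains_sup[OF compact_sphere ne cont] by auto
  define \<mu> where "\<mu> = x \<bullet> (A *v x)"
  define B where "B = \<mu> *\<^sub>R mat 1 - A"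
  have Bv: "B *v y = \<mu> *\<^sub>R y - A *v y" for y
    by (simp add: B_def matrix_vector_mult_diff_rdistrib scaleR_matrix_vector_assoc[symmetric])
  have max: "y \<bullet> (A *v y) \<le> \<mu> * (y \<bullet> y)" for y
  proof (cases "y = 0")
    case False
    define u where "u = y /\<^sub>R norm y"
    have "norm u = 1" and y: "y = norm y *\<^sub>R u" using False by (simp_all add: u_def)
    have "y \<bullet> (A *v y) = (norm y)\<^sup>2 * (u \<bullet> (A *v u))"
      by (subst (1 2) y) (simp add: matrix_vector_mult_scaleR power2_eq_square)
    also have "\<dots> \<le> (norm y)\<^sup>2 * \<mu>"
      unfolding \<mu>_def by (intro mult_left_mono sup \<open>norm u = 1\<close>) simp
    finally show ?thesis by (simp add: power2_norm_eq_inner mult.commute)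
  qed simp
  have "transpose B = B"
    using sym by (auto simp: B_def vec_eq_iff transpose_def mat_def)
  moreover have "0 \<le> y \<bullet> (B *v y)" for y
    using max[of y] by (simp add: Bv inner_simps)
  moreover have "x \<bullet> (B *v x) = 0"
    using nx by (simp add: Bv inner_simps \<mu>_def norm_eq_1)
  ultimately have "B *v x = 0" by (rule psd_isotropic_imp_kernel)
  then have "A *v x = \<mu> *\<^sub>R x" by (simp add: Bv)
  then show ?thesis using that nx max by blast
qed

lemma symmetric_eq_0_if_quadratic_form_0:
  fixes A :: "real ^ 'n ^ 'n"
  assumes sym: "transpose A = A" and "\<And>y. y \<bullet> (A *v y) = 0"
  shows "A = 0"
proof -
  have "A *v x = 0" for x
    using psd_isotropic_imp_kernel[OF sym] assms(2) by simp
  then show ?thesis by (simp add: matrix_eq)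
qed

text \<open>The quadratic form of \<open>A\<close> lies between the smallest and the largest eigenvalue, and the
  smallest one is minus the largest eigenvalue of \<open>- A\<close>.\<close>

lemma symmetric_eq_0_if_no_nonzero_eigenvalue:
  fixes A :: "real ^ 'n ^ 'n"
  assumes sym: "transpose A = A"
    and none: "\<And>\<mu> x. x \<noteq> 0 \<Longrightarrow> A *v x = \<mu> *\<^sub>R x \<Longrightarrow> \<mu> = 0"
  shows "A = 0"
proof (rule symmetric_eq_0_if_quadratic_form_0[OF sym])
  fix y
  have neg: "(- A) *v x = - (A *v x)" for x
    using matrix_vector_mult_diff_rdistrib[of 0 A x] by simp
  obtain \<mu> x where \<mu>: "norm x = 1" "A *v x = \<mu> *\<^sub>R x" "\<And>y. y \<bullet> (A *v y) \<le> \<mu> * (y \<bullet> y)"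
    using symmetric_max_eigenvalue[OF sym] by blast
  have "transpose (- A) = - A" using sym by (simp add: vec_eq_iff transpose_def)
  then obtain \<nu> z where \<nu>: "norm z = 1" "(- A) *v z = \<nu> *\<^sub>R z"
      "\<And>y. y \<bullet> ((- A) *v y) \<le> \<nu> * (y \<bullet> y)"
    using symmetric_max_eigenvalue by blast
  have "\<mu> = 0" using none[of x \<mu>] \<mu> by force
  moreover have "- \<nu> = 0"
    using \<nu>(1) by (intro none[of z]) (auto simp: \<nu>(2)[unfolded neg, symmetric])
  ultimately show "y \<bullet> (A *v y) = 0"
    using \<mu>(3)[of y] \<nu>(3)[of y] by (simp add: neg)
qed

section \<open>Hotelling deflation of the characteristic polynomial\<close>

lemma poly_charpoly: "poly (charpoly A) t = det (t *\<^sub>R mat 1 - A)"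
  by (simp add: charpoly_def det_def poly_sum poly_prod mat_def if_distrib if_distribR
      cong: if_cong)

lemma charpoly_root_iff_eigenvector:
  fixes A :: "real ^ 'n ^ 'n"
  shows "poly (charpoly A) t = 0 \<longleftrightarrow> (\<exists>x. x \<noteq> 0 \<and> A *v x = t *\<^sub>R x)"
proof -
  have "poly (charpoly A) t = 0 \<longleftrightarrow> (\<exists>x. x \<noteq> 0 \<and> (t *\<^sub>R mat 1 - A) *v x = 0)"
    by (metis poly_charpoly invertible_det_nz invertible_left_inverse matrix_left_invertible_ker)
  also have "\<dots> \<longleftrightarrow> (\<exists>x. x \<noteq> 0 \<and> A *v x = t *\<^sub>R x)"
    by (auto simp: matrix_vector_mult_diff_rdistrib scaleR_matrix_vector_assoc[symmetric])
  finally show ?thesis .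
qed

text \<open>No number above the operator norm is an eigenvalue.\<close>

lemma charpoly_nonzero:
  fixes A :: "real ^ 'n ^ 'n"
  shows "charpoly A \<noteq> 0"
proof
  assume "charpoly A = 0"
  then obtain x where x: "x \<noteq> 0" "A *v x = (onorm ((*v) A) + 1) *\<^sub>R x"
    using charpoly_root_iff_eigenvector[of A "onorm ((*v) A) + 1"] by auto
  have bl: "bounded_linear ((*v) A)" by (rule matrix_vector_mul_bounded_linear)
  have "norm (A *v x) \<le> onorm ((*v) A) * norm x"
    using onorm[OF bl] by simp
  moreover have "norm (A *v x) = (onorm ((*v) A) + 1) * norm x"
    using onorm_pos_le[OF bl] by (simp add: x)
  ultimately show False using x(1) by (simp add: algebra_simps)
qed

text \<open>An orthogonal map taking a coordinate axis to \<open>e\<close> conjugates the matrix to a diagonal one.\<close>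

lemma det_mat_minus_rank_one:
  fixes e :: "real ^ 'n"
  assumes "norm e = 1"
  shows "det (mat 1 - c *\<^sub>R outer e e) = 1 - c"
proof -
  fix k :: 'n
  have "norm (axis k 1 :: real ^ 'n) = 1" by simp
  then obtain f :: "real ^ 'n \<Rightarrow> real ^ 'n"
    where f: "orthogonal_transformation f" "f (axis k 1) = e"
    using assms by (rule orthogonal_transformation_exists_1)
  define Q where "Q = matrix f"
  have Q: "orthogonal_matrix Q" and Qv: "Q *v x = f x" for x
    using f(1) by (auto simp: Q_def orthogonal_transformation_matrix matrix_works)
  have QQ: "Q ** transpose Q = mat 1" "transpose Q ** Q = mat 1"
    using Q by (auto simp: orthogonal_matrix_def)
  define D where "D = mat 1 - c *\<^sub>R outer (axis k 1) (axis k 1 :: real ^ 'n)"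
  have "mat 1 - c *\<^sub>R outer e e = Q ** D ** transpose Q"
  proof (subst matrix_eq, intro allI)
    fix x
    define y where "y = transpose Q *v x"
    have Qy: "Q *v y = x"
      by (simp only: y_def matrix_vector_mul_assoc QQ matrix_vector_mul_lid)
    have in_e: "axis k 1 \<bullet> y = e \<bullet> x"
      by (metis Qy Qv f orthogonal_transformation_def)
    have Qax: "Q *v axis k 1 = e" by (simp add: Qv f(2))
    have "(Q ** D ** transpose Q) *v x = Q *v (D *v y)"
      by (simp only: y_def matrix_vector_mul_assoc matrix_mul_assoc)
    also have "\<dots> = x - (c * (e \<bullet> x)) *\<^sub>R e"
      by (simp add: D_def matrix_vector_mult_diff_rdistrib scaleR_matrix_vector_assoc[symmetric]
          outer_mult_vec in_e matrix_vector_mult_diff_distrib matrix_vector_mult_scaleR Qy Qax)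
    finally show "(mat 1 - c *\<^sub>R outer e e) *v x = (Q ** D ** transpose Q) *v x"
      by (simp add: matrix_vector_mult_diff_rdistrib scaleR_matrix_vector_assoc[symmetric]
          outer_mult_vec)
  qed
  then have "det (mat 1 - c *\<^sub>R outer e e) = det (Q ** transpose Q) * det D"
    by (simp add: det_mul)
  also have "\<dots> = det D" by (simp add: QQ)
  also have "\<dots> = (\<Prod>i\<in>UNIV. D $ i $ i)"
    by (rule det_diagonal) (auto simp: D_def mat_def outer_def axis_def)
  also have "\<dots> = (\<Prod>i\<in>UNIV. if i = k then 1 - c else 1)"
    by (rule prod.cong) (auto simp: D_def mat_def outer_def axis_def)
  finally show ?thesis by simp
qed

text \<open>Subtracting \<open>\<mu> e e\<^sup>T\<close> turns the eigenvalue \<open>\<mu>\<close> of \<open>e\<close> into \<open>0\<close> and keeps all other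
  eigenvalues. For \<open>t \<noteq> 0\<close> this is the determinant of
  \<open>t I - A = (t I - R) (I - (\<mu> / t) e e\<^sup>T)\<close>, where \<open>R = A - \<mu> e e\<^sup>T\<close> satisfies \<open>R e = 0\<close>.\<close>

lemma charpoly_deflation:
  fixes A :: "real ^ 'n ^ 'n"
  assumes e: "norm e = 1" and Ae: "A *v e = \<mu> *\<^sub>R e"
  shows "[:0, 1:] * charpoly A = [:- \<mu>, 1:] * charpoly (A - \<mu> *\<^sub>R outer e e)"
    (is "?p = ?q")
proof -
  define R where "R = A - \<mu> *\<^sub>R outer e e"
  have "e \<bullet> e = 1" using e by (simp add: norm_eq_1)
  then have Re: "R *v e = 0"
    by (simp add: R_def matrix_vector_mult_diff_rdistrib scaleR_matrix_vector_assoc[symmetric]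
        outer_mult_vec Ae)
  have "poly (?p - ?q) t = 0" if t: "t \<noteq> 0" for t
  proof -
    have "t *\<^sub>R mat 1 - A = (t *\<^sub>R mat 1 - R) ** (mat 1 - (\<mu> / t) *\<^sub>R outer e e)"
      using t
      by (subst matrix_eq)
         (simp add: matrix_vector_mul_assoc[symmetric] matrix_vector_mult_diff_rdistrib
          scaleR_matrix_vector_assoc[symmetric] outer_mult_vec matrix_vector_mult_diff_distrib
          matrix_vector_mult_scaleR Re, simp add: R_def matrix_vector_mult_diff_rdistrib
          scaleR_matrix_vector_assoc[symmetric] outer_mult_vec algebra_simps)
    then have "det (t *\<^sub>R mat 1 - A) = det (t *\<^sub>R mat 1 - R) * (1 - \<mu> / t)"
      by (simp add: det_mul det_mat_minus_rank_one[OF e])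
    then show ?thesis using t by (simp add: poly_charpoly R_def field_simps)
  qed
  then have "UNIV - {0} \<subseteq> {t. poly (?p - ?q) t = 0}" by blast
  moreover have "infinite (UNIV - {0 :: real})" by (simp add: infinite_UNIV_char_0)
  ultimately have "infinite {t. poly (?p - ?q) t = 0}" using finite_subset by blast
  then have "?p - ?q = 0" using poly_roots_finite by blast
  then show ?thesis by simp
qed

abbreviation (input) nonzero_eigenvalues :: "real ^ 'n ^ 'n \<Rightarrow> real multiset" where
  "nonzero_eigenvalues A \<equiv> filter_mset (\<lambda>x. x \<noteq> 0) (eigenvalues A)"

lemma nonzero_eigenvalues_deflation:
  fixes A :: "real ^ 'n ^ 'n"
  assumes "norm e = 1" "A *v e = \<mu> *\<^sub>R e" "\<mu> \<noteq> 0"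
  shows "nonzero_eigenvalues A = add_mset \<mu> (nonzero_eigenvalues (A - \<mu> *\<^sub>R outer e e))"
proof -
  have "proots ([:0, 1:] * charpoly A) =
      proots ([:- \<mu>, 1:] * charpoly (A - \<mu> *\<^sub>R outer e e))"
    using charpoly_deflation[OF assms(1,2)] by simp
  then have "add_mset 0 (eigenvalues A) = add_mset \<mu> (eigenvalues (A - \<mu> *\<^sub>R outer e e))"
    by (simp add: proots_mult charpoly_nonzero eigenvalues_def del: mult_pCons_left)
  from arg_cong[OF this, of "filter_mset (\<lambda>x. x \<noteq> 0)"] show ?thesis
    using assms(3) by simp
qed

lemma nonzero_eigenvalues_orthonormal_deflation:
  fixes A :: "real ^ 'n ^ 'n"
  assumes "finite I"
    and "\<And>i. i \<in> I \<Longrightarrow> A *v e i = lam i *\<^sub>R e i"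
    and "\<And>i j. i \<in> I \<Longrightarrow> j \<in> I \<Longrightarrow> e i \<bullet> e j = (if i = j then 1 else 0)"
    and "\<And>i. i \<in> I \<Longrightarrow> lam i \<noteq> 0"
  shows "nonzero_eigenvalues A =
    image_mset lam (mset_set I) + nonzero_eigenvalues (A - (\<Sum>i\<in>I. lam i *\<^sub>R outer (e i) (e i)))"
  using assms
proof (induction I)
  case (insert j I)
  define R where "R = A - (\<Sum>i\<in>I. lam i *\<^sub>R outer (e i) (e i))"
  have IH: "nonzero_eigenvalues A = image_mset lam (mset_set I) + nonzero_eigenvalues R"
    unfolding R_def using insert.prems by (intro insert.IH) auto
  have "(\<Sum>i\<in>I. (lam i * (e i \<bullet> e j)) *\<^sub>R e i) = 0"
    using insert.prems(2)[of _ j] insert.hyps by (intro sum.neutral) auto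
  then have "R *v e j = lam j *\<^sub>R e j"
    using insert.prems(1)[of j]
    by (simp add: R_def matrix_vector_mult_diff_rdistrib scaleR_outer_sum_mult_vec)
  moreover have "norm (e j) = 1"
    using insert.prems(2)[of j j] by (simp add: norm_eq_1)
  ultimately have "nonzero_eigenvalues R =
      add_mset (lam j) (nonzero_eigenvalues (R - lam j *\<^sub>R outer (e j) (e j)))"
    using insert.prems(3)[of j] by (intro nonzero_eigenvalues_deflation) auto
  moreover have "R - lam j *\<^sub>R outer (e j) (e j) =
      A - (\<Sum>i\<in>insert j I. lam i *\<^sub>R outer (e i) (e i))"
    using insert.hyps by (simp add: R_def algebra_simps)
  ultimately show ?case using IH insert.hyps by simp
qed simp

text \<open>If the eigenvalues of an orthonormal family exhaust the non-zero spectrum with multiplicity,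
  then deflating by the whole family leaves a symmetric matrix with no non-zero eigenvalue.\<close>

theorem symmetric_eq_sum_outer_eigenvectors:
  fixes A :: "real ^ 'n ^ 'n"
  assumes sym: "transpose A = A" and "finite I"
    and "\<And>i. i \<in> I \<Longrightarrow> A *v e i = lam i *\<^sub>R e i"
    and "\<And>i j. i \<in> I \<Longrightarrow> j \<in> I \<Longrightarrow> e i \<bullet> e j = (if i = j then 1 else 0)"
    and spec: "nonzero_eigenvalues A = image_mset lam (mset_set I)"
  shows "A = (\<Sum>i\<in>I. lam i *\<^sub>R outer (e i) (e i))"
proof -
  define R where "R = A - (\<Sum>i\<in>I. lam i *\<^sub>R outer (e i) (e i))"
  have "lam i \<noteq> 0" if "i \<in> I" for i
  proof -
    have "lam i \<in># nonzero_eigenvalues A" using that \<open>finite I\<close> by (simp add: spec)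
    then show ?thesis by simp
  qed
  then have "nonzero_eigenvalues A = image_mset lam (mset_set I) + nonzero_eigenvalues R"
    unfolding R_def using assms by (intro nonzero_eigenvalues_orthonormal_deflation) auto
  then have empty: "nonzero_eigenvalues R = {#}" using spec by simp
  have "R = 0"
  proof (rule symmetric_eq_0_if_no_nonzero_eigenvalue)
    have "transpose (B - C) = transpose B - transpose C" for B C :: "real ^ 'n ^ 'n"
      by (simp add: vec_eq_iff transpose_def)
    then show "transpose R = R" by (simp add: R_def sym transpose_outer_sum)
  next
    fix \<mu> x assume "x \<noteq> 0" "R *v x = \<mu> *\<^sub>R x"
    then have "poly (charpoly R) \<mu> = 0" using charpoly_root_iff_eigenvector by blast
    then have "\<mu> \<in># eigenvalues R"
      by (simp add: eigenvalues_def set_count_proots[OF charpoly_nonzero])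
    then have "\<mu> \<in># nonzero_eigenvalues R" if "\<mu> \<noteq> 0" using that by simp
    then show "\<mu> = 0" unfolding empty by auto
  qed
  then show ?thesis by (simp add: R_def)
qed

section \<open>Raw moments from central moments\<close>

lemma momentum_eq_weight_drift:
  assumes "total_weight m g \<noteq> 0"
  shows "momentum m v g = total_weight m g *\<^sub>R drift_velocity m v g"
  using assms by (simp add: drift_velocity_def)

lemma central_momentum_eq_0:
  assumes "total_weight m g \<noteq> 0"
  shows "(\<Sum>i=1..m. g i *\<^sub>R (v i - drift_velocity m v g)) = 0"
  using momentum_eq_weight_drift[OF assms, of v]
  by (simp add: scaleR_diff_right sum_subtractf momentum_def total_weight_def
      scaleR_sum_left[symmetric])

text \<open>In the expansion around the drift velocity the mixed terms are linear in the peculiar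
  velocities, whose weighted sum is zero.\<close>

lemma momentum_flux_eq_pressure_tensor:
  assumes "total_weight m g \<noteq> 0"
  shows "momentum_flux m v g = pressure_tensor m v g
    + total_weight m g *\<^sub>R outer (drift_velocity m v g) (drift_velocity m v g)"
proof -
  define V where "V = drift_velocity m v g"
  define w where "w i = v i - V" for i
  have w0: "(\<Sum>i=1..m. g i *\<^sub>R w i) = 0"
    using central_momentum_eq_0[OF assms] by (simp add: w_def V_def)
  have comp: "(\<Sum>i=1..m. g i * w i $ a) = 0" for a
    using arg_cong[OF w0, of "\<lambda>x. x $ a"] by simp
  have 1: "(\<Sum>i=1..m. g i *\<^sub>R outer (w i) V) = 0"
    using comp by (simp add: vec_eq_iff outer_def mult.assoc[symmetric] sum_distrib_right[symmetric])
  have 2: "(\<Sum>i=1..m. g i *\<^sub>R outer V (w i)) = 0"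
  proof -
    have "(\<Sum>i=1..m. g i * (V $ a * w i $ b)) = V $ a * (\<Sum>i=1..m. g i * w i $ b)" for a b
      by (simp add: sum_distrib_left mult.left_commute)
    then show ?thesis using comp by (simp add: vec_eq_iff outer_def)
  qed
  have v: "v i = w i + V" for i by (simp add: w_def)
  have "momentum_flux m v g = (\<Sum>i=1..m. g i *\<^sub>R outer (w i) (w i))
      + (\<Sum>i=1..m. g i *\<^sub>R outer (w i) V) + (\<Sum>i=1..m. g i *\<^sub>R outer V (w i))
      + (\<Sum>i=1..m. g i) *\<^sub>R outer V V"
    unfolding momentum_flux_def v outer_add_add scaleR_add_right sum.distrib scaleR_sum_left ..
  then show ?thesis
    unfolding 1 2 by (simp add: pressure_tensor_def total_weight_def w_def V_def)
qed

lemma trace_outer_sum: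
  fixes w :: "'i \<Rightarrow> real ^ 'n"
  shows "trace (\<Sum>i\<in>I. c i *\<^sub>R outer (w i) (w i)) = (\<Sum>i\<in>I. c i * (norm (w i))\<^sup>2)"
  by (simp add: trace_def outer_def power2_norm_eq_inner inner_vec_def sum_distrib_left)
     (rule sum.swap)

lemma trace_pressure_tensor:
  "trace (pressure_tensor m v g) = (\<Sum>i=1..m. g i * (norm (v i - drift_velocity m v g))\<^sup>2)"
  by (simp add: pressure_tensor_def trace_outer_sum)

text \<open>With \<open>v = w + V\<close>, the weighted sum of \<open>|v|\<^sup>2 v\<close> splits by degree in \<open>w\<close>: degree 3 gives the
  central heat flux, degree 2 contracts to \<open>trace P V + 2 P V\<close>, degree 1 cancels.\<close>

lemma raw_heat_flux_eq_central:
  assumes "total_weight m g \<noteq> 0"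
  shows "raw_heat_flux m v g = central_heat_flux m v g
    + pressure_tensor m v g *v drift_velocity m v g
    + (trace (pressure_tensor m v g) / 2) *\<^sub>R drift_velocity m v g
    + (total_weight m g * (norm (drift_velocity m v g))\<^sup>2 / 2) *\<^sub>R drift_velocity m v g"
proof -
  define V where "V = drift_velocity m v g"
  define w where "w i = v i - V" for i
  have w0: "(\<Sum>i=1..m. g i *\<^sub>R w i) = 0"
    using central_momentum_eq_0[OF assms] by (simp add: w_def V_def)
  have wV: "(\<Sum>i=1..m. g i * (w i \<bullet> V)) = 0"
    using arg_cong[OF w0, of "\<lambda>x. x \<bullet> V"] by (simp add: inner_sum_left)
  have term_eq: "(g i * (norm (v i))\<^sup>2) *\<^sub>R v i = (g i * (norm (w i))\<^sup>2) *\<^sub>R w i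
      + (g i * (norm (w i))\<^sup>2) *\<^sub>R V + 2 *\<^sub>R ((g i * (w i \<bullet> V)) *\<^sub>R w i)
      + (2 * (g i * (w i \<bullet> V))) *\<^sub>R V + (norm V)\<^sup>2 *\<^sub>R (g i *\<^sub>R w i)
      + (g i * (norm V)\<^sup>2) *\<^sub>R V" for i
  proof -
    have v: "v i = w i + V" by (simp add: w_def)
    have n: "(norm (v i))\<^sup>2 = (norm (w i))\<^sup>2 + 2 * (w i \<bullet> V) + (norm V)\<^sup>2"
      by (simp add: v power2_norm_eq_inner inner_simps inner_commute)
    show ?thesis
      unfolding n unfolding v by (simp add: algebra_simps)
  qed
  have "(\<Sum>i=1..m. (g i * (norm (v i))\<^sup>2) *\<^sub>R v i) = (\<Sum>i=1..m. (g i * (norm (w i))\<^sup>2) *\<^sub>R w i)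
      + (\<Sum>i=1..m. g i * (norm (w i))\<^sup>2) *\<^sub>R V + 2 *\<^sub>R (\<Sum>i=1..m. (g i * (w i \<bullet> V)) *\<^sub>R w i)
      + (2 * (\<Sum>i=1..m. g i * (w i \<bullet> V))) *\<^sub>R V + (norm V)\<^sup>2 *\<^sub>R (\<Sum>i=1..m. g i *\<^sub>R w i)
      + ((\<Sum>i=1..m. g i) * (norm V)\<^sup>2) *\<^sub>R V"
    unfolding term_eq sum.distrib scaleR_sum_left scaleR_sum_right sum_distrib_left
      sum_distrib_right ..
  also have "\<dots> = 2 *\<^sub>R central_heat_flux m v g + trace (pressure_tensor m v g) *\<^sub>R V
      + 2 *\<^sub>R (pressure_tensor m v g *v V) + (total_weight m g * (norm V)\<^sup>2) *\<^sub>R V"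
  proof -
    have "2 *\<^sub>R central_heat_flux m v g = (\<Sum>i=1..m. (g i * (norm (w i))\<^sup>2) *\<^sub>R w i)"
      by (simp add: central_heat_flux_def w_def V_def)
    moreover have "trace (pressure_tensor m v g) = (\<Sum>i=1..m. g i * (norm (w i))\<^sup>2)"
      by (simp add: trace_pressure_tensor w_def V_def)
    moreover have "pressure_tensor m v g *v V = (\<Sum>i=1..m. (g i * (w i \<bullet> V)) *\<^sub>R w i)"
      by (simp add: pressure_tensor_def scaleR_outer_sum_mult_vec w_def V_def)
    ultimately show ?thesis
      unfolding w0 wV by (simp add: total_weight_def)
  qed
  finally show ?thesis
    by (simp add: raw_heat_flux_def V_def scaleR_add_right algebra_simps)
qed

section \<open>The range of the pressure tensor\<close>

lemma inner_pressure_tensor: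
  "x \<bullet> (pressure_tensor m v g *v x) = (\<Sum>i=1..m. g i * ((v i - drift_velocity m v g) \<bullet> x)\<^sup>2)"
  by (simp add: pressure_tensor_def scaleR_outer_sum_mult_vec inner_sum_right power2_eq_square
      inner_commute mult_ac)

lemma pressure_tensor_psd:
  assumes "stochastic_group m v g"
  shows "0 \<le> x \<bullet> (pressure_tensor m v g *v x)"
  unfolding inner_pressure_tensor using assms
  by (intro sum_nonneg mult_nonneg_nonneg) (auto simp: stochastic_group_def less_imp_le)

text \<open>Positive weights force every peculiar velocity to be orthogonal to the kernel of the
  pressure tensor, and the heat flux is a combination of peculiar velocities.\<close>

lemma central_heat_flux_orthogonal_kernel:
  assumes grp: "stochastic_group m v g" and x: "pressure_tensor m v g *v x = 0"
  shows "central_heat_flux m v g \<bullet> x = 0"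
proof -
  define w where "w i = v i - drift_velocity m v g" for i
  have "(\<Sum>i=1..m. g i * (w i \<bullet> x)\<^sup>2) = 0"
    using x inner_pressure_tensor[of x m v g] by (simp add: w_def)
  then have "\<forall>i\<in>{1..m}. g i * (w i \<bullet> x)\<^sup>2 = 0"
    using grp by (subst (asm) sum_nonneg_eq_0_iff) (auto simp: stochastic_group_def less_imp_le)
  then have "\<forall>i\<in>{1..m}. w i \<bullet> x = 0"
    using grp by (force simp: stochastic_group_def)
  then show ?thesis
    by (simp add: central_heat_flux_def inner_sum_left w_def)
qed

lemma central_heat_flux_eigenvector_expansion:
  assumes grp: "stochastic_group m v g" and fin: "finite I"
    and orth: "\<And>i j. i \<in> I \<Longrightarrow> j \<in> I \<Longrightarrow> e i \<bullet> e j = (if i = j then 1 else 0)"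
    and P: "pressure_tensor m v g = (\<Sum>i\<in>I. lam i *\<^sub>R outer (e i) (e i))"
  shows "central_heat_flux m v g = (\<Sum>i\<in>I. (e i \<bullet> central_heat_flux m v g) *\<^sub>R e i)"
proof -
  define q where "q = central_heat_flux m v g"
  define p where "p = (\<Sum>i\<in>I. (e i \<bullet> q) *\<^sub>R e i)"
  have ep: "e j \<bullet> p = e j \<bullet> q" if "j \<in> I" for j
  proof -
    have "e j \<bullet> p = (\<Sum>i\<in>I. if i = j then e i \<bullet> q else 0)"
      unfolding p_def inner_sum_right using orth that by (intro sum.cong) auto
    then show ?thesis using that fin by simp
  qed
  then have zero: "e j \<bullet> (q - p) = 0" if "j \<in> I" for j
    using that by (simp add: inner_diff_right)
  have "pressure_tensor m v g *v (q - p) = 0"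
    unfolding P scaleR_outer_sum_mult_vec by (simp add: zero)
  then have "q \<bullet> (q - p) = 0"
    using central_heat_flux_orthogonal_kernel[OF grp] by (simp add: q_def)
  moreover have "p \<bullet> (q - p) = 0"
    by (subst p_def) (simp add: inner_sum_left zero)
  ultimately have "(q - p) \<bullet> (q - p) = 0" by (simp add: inner_diff_left)
  then show ?thesis by (simp add: p_def q_def)
qed

section \<open>Matching moments with two particles on a line\<close>

text \<open>With \<open>c = \<rho> / k\<close> and \<open>a = sqrt (\<lambda> / c)\<close>, two masses at \<open>\<gamma> a\<close> and \<open>- a / \<gamma>\<close> with ratio
  \<open>1 : \<gamma>\<^sup>2\<close> have mean zero and second moment \<open>c a\<^sup>2 = \<lambda>\<close> for every \<open>\<gamma> > 0\<close>. The third moment is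
  \<open>c a\<^sup>3 (\<gamma> - 1 / \<gamma>)\<close>, and the formula for \<open>\<gamma>\<close> is the positive root of \<open>\<gamma> - 1 / \<gamma> = 2 s\<close> for the
  skewness parameter \<open>s\<close> with \<open>c a\<^sup>3 s = h\<close>.\<close>

lemma two_particle_moments:
  fixes \<rho> k lam h \<gamma> :: real
  assumes pos: "0 < \<rho>" "0 < k" "0 < lam" "0 < h"
    and \<gamma>: "\<gamma> = sqrt \<rho> * h / (sqrt k * lam powr (3 / 2)) + sqrt (1 + \<rho> * h\<^sup>2 / (k * lam ^ 3))"
  defines "a \<equiv> sqrt (k * lam / \<rho>)"
    and "g1 \<equiv> \<rho> / k * (1 / (1 + \<gamma>\<^sup>2))" and "g2 \<equiv> \<rho> / k * (\<gamma>\<^sup>2 / (1 + \<gamma>\<^sup>2))"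
  shows "0 < \<gamma>" "0 < g1" "0 < g2" "g1 + g2 = \<rho> / k"
    and "g1 * (\<gamma> * a) - g2 * (1 / \<gamma> * a) = 0"
    and "g1 * (\<gamma> * a)\<^sup>2 + g2 * (1 / \<gamma> * a)\<^sup>2 = lam"
    and "g1 * (\<gamma> * a) ^ 3 - g2 * (1 / \<gamma> * a) ^ 3 = 2 * h"
proof -
  define s where "s = sqrt \<rho> * h / (sqrt k * lam powr (3 / 2))"
  define c where "c = \<rho> / k"
  have c: "0 < c" using pos by (simp add: c_def)
  have s: "0 < s" using pos by (simp add: s_def)
  have "(lam powr (3 / 2))\<^sup>2 = lam ^ 3"
    using pos by (simp add: powr_power powr_numeral)
  then have s2: "s\<^sup>2 = \<rho> * h\<^sup>2 / (k * lam ^ 3)"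
    using pos by (simp add: s_def power_divide power_mult_distrib)
  have \<gamma>s: "\<gamma> = s + sqrt (1 + s\<^sup>2)" by (simp add: \<gamma> s_def[symmetric] s2)
  then show \<gamma>0: "0 < \<gamma>" using s by (simp add: add_pos_nonneg)
  have "(\<gamma> - s)\<^sup>2 = 1 + s\<^sup>2" by (simp add: \<gamma>s)
  then have quad: "\<gamma>\<^sup>2 = 1 + 2 * s * \<gamma>" by (simp add: power2_eq_square algebra_simps)
  have N: "0 < 1 + \<gamma>\<^sup>2" by (simp add: add_pos_nonneg)
  show "0 < g1" "0 < g2" using pos N \<gamma>0 by (simp_all add: g1_def g2_def)
  have g1: "g1 * (1 + \<gamma>\<^sup>2) = c" and g2: "g2 = g1 * \<gamma>\<^sup>2"
    using N by (simp_all add: g1_def g2_def c_def)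
  show "g1 + g2 = \<rho> / k" using g1 by (simp add: g2 c_def algebra_simps)
  show "g1 * (\<gamma> * a) - g2 * (1 / \<gamma> * a) = 0"
    using \<gamma>0 by (simp add: g2 power2_eq_square)
  have a: "0 < a" and a2: "c * a\<^sup>2 = lam" using pos by (simp_all add: a_def c_def)
  have "g1 * (\<gamma> * a)\<^sup>2 + g2 * (1 / \<gamma> * a)\<^sup>2 = g1 * (1 + \<gamma>\<^sup>2) * a\<^sup>2"
    using \<gamma>0 by (simp add: g2 field_simps power2_eq_square)
  then show "g1 * (\<gamma> * a)\<^sup>2 + g2 * (1 / \<gamma> * a)\<^sup>2 = lam" by (simp add: g1 a2)
  have "(c * a ^ 3 * s)\<^sup>2 = (c * a\<^sup>2) ^ 3 * (s\<^sup>2 / c)"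
    using c by (simp add: power_mult_distrib power2_eq_square power3_eq_cube field_simps)
  also have "\<dots> = h\<^sup>2"
    unfolding a2 s2 unfolding c_def using pos by simp
  finally have cas: "c * a ^ 3 * s = h"
    using c a s pos by (simp add: power2_eq_iff_nonneg)
  have "g1 * (\<gamma> * a) ^ 3 - g2 * (1 / \<gamma> * a) ^ 3 = g1 * a ^ 3 * (\<gamma> ^ 3 - 1 / \<gamma>)"
    using \<gamma>0 by (simp add: g2 field_simps power2_eq_square power3_eq_cube)
  also have "\<gamma> ^ 3 - 1 / \<gamma> = (1 + \<gamma>\<^sup>2) * ((\<gamma>\<^sup>2 - 1) / \<gamma>)"
    using \<gamma>0 by (simp add: field_simps power2_eq_square power3_eq_cube)
  also have "(\<gamma>\<^sup>2 - 1) / \<gamma> = 2 * s" using quad \<gamma>0 by simp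
  also have "g1 * a ^ 3 * ((1 + \<gamma>\<^sup>2) * (2 * s)) = 2 * (g1 * (1 + \<gamma>\<^sup>2) * a ^ 3 * s)" by simp
  also have "\<dots> = 2 * h" by (simp only: g1 cas)
  finally show "g1 * (\<gamma> * a) ^ 3 - g2 * (1 / \<gamma> * a) ^ 3 = 2 * h" .
qed

section \<open>Reduction of a group to pairs of particles\<close>

lemma sum_pairs:
  fixes f :: "nat \<Rightarrow> 'a :: comm_monoid_add"
  shows "(\<Sum>i=1..2*k. f i) = (\<Sum>i=1..k. f i + f (i + k))"
proof -
  have "(\<Sum>i=1..2*k. f i) = (\<Sum>i=1..k. f i) + (\<Sum>i=k+1..2*k. f i)"
    using sum.ub_add_nat[of 1 k f k] by (simp add: mult_2)
  also have "(\<Sum>i=k+1..2*k. f i) = (\<Sum>i=1..k. f (i + k))"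
    using sum.shift_bounds_cl_nat_ivl[of f 1 k k] by (simp add: mult_2 add.commute)
  finally show ?thesis by (simp add: sum.distrib)
qed

text \<open>The reduced group is a superposition of \<open>k\<close> pairs, the \<open>i\<close>-th one on the line through the
  drift velocity in direction \<open>e i\<close>. Its second and third central moments are therefore sums of
  one-dimensional moments along the \<open>e i\<close>.\<close>

lemma paired_group_moments:
  fixes e :: "nat \<Rightarrow> real ^ 3" and b d :: "nat \<Rightarrow> real"
  assumes \<rho>: "\<rho> \<noteq> 0" and k: "0 < k"
    and unit: "\<And>i. i \<in> {1..k} \<Longrightarrow> norm (e i) = 1"
    and v1: "\<And>i. i \<in> {1..k} \<Longrightarrow> v i = V + b i *\<^sub>R e i"
    and v2: "\<And>i. i \<in> {1..k} \<Longrightarrow> v (i + k) = V - d i *\<^sub>R e i"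
    and m0: "\<And>i. i \<in> {1..k} \<Longrightarrow> g i + g (i + k) = \<rho> / real k"
    and m1: "\<And>i. i \<in> {1..k} \<Longrightarrow> g i * b i - g (i + k) * d i = 0"
    and m2: "\<And>i. i \<in> {1..k} \<Longrightarrow> g i * (b i)\<^sup>2 + g (i + k) * (d i)\<^sup>2 = lam i"
    and m3: "\<And>i. i \<in> {1..k} \<Longrightarrow> g i * b i ^ 3 - g (i + k) * d i ^ 3 = 2 * h i"
  shows "total_weight (2 * k) g = \<rho>" "drift_velocity (2 * k) v g = V"
    and "pressure_tensor (2 * k) v g = (\<Sum>i=1..k. lam i *\<^sub>R outer (e i) (e i))"
    and "central_heat_flux (2 * k) v g = (\<Sum>i=1..k. h i *\<^sub>R e i)"
proof -
  have "total_weight (2 * k) g = (\<Sum>i=1..k. \<rho> / real k)"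
    unfolding total_weight_def sum_pairs by (intro sum.cong refl m0)
  then show tw: "total_weight (2 * k) g = \<rho>" using k by simp
  have "momentum (2 * k) v g = (\<Sum>i=1..k. (\<rho> / real k) *\<^sub>R V)"
    unfolding momentum_def sum_pairs
  proof (intro sum.cong refl)
    fix i assume i: "i \<in> {1..k}"
    have "g i *\<^sub>R v i + g (i + k) *\<^sub>R v (i + k) =
        (g i + g (i + k)) *\<^sub>R V + (g i * b i - g (i + k) * d i) *\<^sub>R e i"
      by (simp add: v1[OF i] v2[OF i] algebra_simps)
    then show "g i *\<^sub>R v i + g (i + k) *\<^sub>R v (i + k) = (\<rho> / real k) *\<^sub>R V"
      by (simp add: m0[OF i] m1[OF i])
  qed
  then have "momentum (2 * k) v g = \<rho> *\<^sub>R V"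
    using k by (simp add: scaleR_sum_left[symmetric] sum_constant_scaleR del: sum_constant)
  then show V: "drift_velocity (2 * k) v g = V"
    using \<rho> by (simp add: drift_velocity_def tw)
  show "pressure_tensor (2 * k) v g = (\<Sum>i=1..k. lam i *\<^sub>R outer (e i) (e i))"
    unfolding pressure_tensor_def V sum_pairs
  proof (intro sum.cong refl)
    fix i assume i: "i \<in> {1..k}"
    have "g i *\<^sub>R outer (v i - V) (v i - V) + g (i + k) *\<^sub>R outer (v (i + k) - V) (v (i + k) - V)
        = (g i * (b i)\<^sup>2 + g (i + k) * (d i)\<^sup>2) *\<^sub>R outer (e i) (e i)"
      by (simp add: v1[OF i] v2[OF i] outer_def vec_eq_iff power2_eq_square algebra_simps)
    then show "g i *\<^sub>R outer (v i - V) (v i - V)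
        + g (i + k) *\<^sub>R outer (v (i + k) - V) (v (i + k) - V) = lam i *\<^sub>R outer (e i) (e i)"
      by (simp add: m2[OF i])
  qed
  have "(\<Sum>i=1..2*k. (g i * (norm (v i - V))\<^sup>2) *\<^sub>R (v i - V)) = (\<Sum>i=1..k. (2 * h i) *\<^sub>R e i)"
    unfolding sum_pairs
  proof (intro sum.cong refl)
    fix i assume i: "i \<in> {1..k}"
    have "(g i * (norm (v i - V))\<^sup>2) *\<^sub>R (v i - V)
        + (g (i + k) * (norm (v (i + k) - V))\<^sup>2) *\<^sub>R (v (i + k) - V)
        = (g i * b i ^ 3 - g (i + k) * d i ^ 3) *\<^sub>R e i"
      by (simp add: v1[OF i] v2[OF i] unit[OF i] power2_eq_square power3_eq_cube algebra_simps)
    then show "(g i * (norm (v i - V))\<^sup>2) *\<^sub>R (v i - V)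
        + (g (i + k) * (norm (v (i + k) - V))\<^sup>2) *\<^sub>R (v (i + k) - V) = (2 * h i) *\<^sub>R e i"
      by (simp add: m3[OF i])
  qed
  then show "central_heat_flux (2 * k) v g = (\<Sum>i=1..k. h i *\<^sub>R e i)"
    by (simp add: central_heat_flux_def V scaleR_sum_right)
qed

theorem theorem3p1:
  fixes m k :: nat
    and v vt :: "nat \<Rightarrow> real ^ 3"
    and g gt lam qh gam :: "nat \<Rightarrow> real"
    and \<Theta> :: "nat \<Rightarrow> real ^ 3"
    and \<rho> :: real and V q :: "real ^ 3" and P :: "real ^ 3 ^ 3"
  assumes "stochastic_group m v g"
    and "\<rho> = total_weight m g"
    and "V = drift_velocity m v g"
    and "P = pressure_tensor m v g"
    and "q = central_heat_flux m v g"
    and "k \<in> {1, 2, 3}"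
    and "filter_mset (\<lambda>x. x \<noteq> 0) (eigenvalues P) = image_mset lam (mset_set {1..k})"
    and "\<And>i. i \<in> {1..k} \<Longrightarrow> P *v \<Theta> i = lam i *\<^sub>R \<Theta> i"
    and "\<And>i j. i \<in> {1..k} \<Longrightarrow> j \<in> {1..k} \<Longrightarrow> \<Theta> i \<bullet> \<Theta> j = (if i = j then 1 else 0)"
    and "\<And>i. i \<in> {1..k} \<Longrightarrow> qh i = \<Theta> i \<bullet> q"
    and "\<And>i. i \<in> {1..k} \<Longrightarrow> qh i > 0"
    and "\<And>i. i \<in> {1..k} \<Longrightarrow>
           gam i = sqrt \<rho> * qh i / (sqrt (real k) * lam i powr (3 / 2))
                   + sqrt (1 + \<rho> * (qh i)\<^sup>2 / (real k * lam i ^ 3))"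
    and "\<And>i. i \<in> {1..k} \<Longrightarrow> vt i = V + (gam i * sqrt (real k * lam i / \<rho>)) *\<^sub>R \<Theta> i"
    and "\<And>i. i \<in> {1..k} \<Longrightarrow> gt i = \<rho> / real k * (1 / (1 + (gam i)\<^sup>2))"
    and "\<And>i. i \<in> {1..k} \<Longrightarrow>
           vt (i + k) = V - (1 / gam i * sqrt (real k * lam i / \<rho>)) *\<^sub>R \<Theta> i"
    and "\<And>i. i \<in> {1..k} \<Longrightarrow> gt (i + k) = \<rho> / real k * ((gam i)\<^sup>2 / (1 + (gam i)\<^sup>2))"
  shows "stochastic_group (2 * k) vt gt
    \<and> total_weight (2 * k) gt = total_weight m g
    \<and> momentum (2 * k) vt gt = momentum m v g
    \<and> momentum_flux (2 * k) vt gt = momentum_flux m v g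
    \<and> pressure_tensor (2 * k) vt gt = pressure_tensor m v g
    \<and> raw_heat_flux (2 * k) vt gt = raw_heat_flux m v g
    \<and> central_heat_flux (2 * k) vt gt = central_heat_flux m v g"
proof -
  note grp = assms(1) and \<rho> = assms(2) and V = assms(3) and P = assms(4) and q = assms(5)
    and spec = assms(7) and eig = assms(8) and orth = assms(9)
  have k: "0 < k" using assms(6) by auto
  have Psum: "P = (\<Sum>i=1..k. lam i *\<^sub>R outer (\<Theta> i) (\<Theta> i))"
    using eig orth spec
    by (intro symmetric_eq_sum_outer_eigenvectors) (auto simp: P pressure_tensor_def transpose_outer_sum)
  have unit: "norm (\<Theta> i) = 1" if "i \<in> {1..k}" for i
    using orth[of i i] that by (simp add: norm_eq_1)
  have lam: "0 < lam i" if "i \<in> {1..k}" for i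
  proof -
    have "lam i \<in># nonzero_eigenvalues P" using that by (simp add: spec)
    then have "lam i \<noteq> 0" by simp
    moreover have "0 \<le> \<Theta> i \<bullet> (P *v \<Theta> i)" unfolding P by (rule pressure_tensor_psd[OF grp])
    then have "0 \<le> lam i" using eig[of i] orth[of i i] that by simp
    ultimately show ?thesis by simp
  qed
  \<comment> \<open>An empty group would have pressure tensor \<open>0\<close>, which has no non-zero eigenvalue.\<close>
  have "m \<noteq> 0"
  proof
    assume "m = 0"
    then have "P *v \<Theta> 1 = 0" by (simp add: P pressure_tensor_def)
    then have "lam 1 *\<^sub>R \<Theta> 1 = 0" using eig[of 1] k by simp
    then show False using lam[of 1] unit[of 1] k by auto
  qed
  then have \<rho>0: "0 < \<rho>"
    unfolding \<rho> total_weight_def using grp by (intro sum_pos) (auto simp: stochastic_group_def)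
  have pair: "0 < gt i" "0 < gt (i + k)" "gt i + gt (i + k) = \<rho> / real k"
    "gt i * (gam i * sqrt (real k * lam i / \<rho>))
       - gt (i + k) * (1 / gam i * sqrt (real k * lam i / \<rho>)) = 0"
    "gt i * (gam i * sqrt (real k * lam i / \<rho>))\<^sup>2
       + gt (i + k) * (1 / gam i * sqrt (real k * lam i / \<rho>))\<^sup>2 = lam i"
    "gt i * (gam i * sqrt (real k * lam i / \<rho>)) ^ 3
       - gt (i + k) * (1 / gam i * sqrt (real k * lam i / \<rho>)) ^ 3 = 2 * qh i"
    if i: "i \<in> {1..k}" for i
    unfolding assms(14)[OF i] assms(16)[OF i]
    using two_particle_moments[OF \<rho>0 _ lam[OF i] assms(11)[OF i] assms(12)[OF i]] k by simp_all
  note red = paired_group_moments[where v = vt and g = gt and V = V and e = \<Theta> and lam = lam and h = qh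
      and b = "\<lambda>i. gam i * sqrt (real k * lam i / \<rho>)"
      and d = "\<lambda>i. 1 / gam i * sqrt (real k * lam i / \<rho>)",
      OF less_imp_neq[OF \<rho>0, symmetric] k unit assms(13) assms(15) pair(3-6)]
  have tw: "total_weight (2 * k) gt = total_weight m g"
    using red(1) by (simp add: \<rho>)
  have drift: "drift_velocity (2 * k) vt gt = drift_velocity m v g"
    using red(2) by (simp add: V)
  have pressure: "pressure_tensor (2 * k) vt gt = pressure_tensor m v g"
    using red(3) Psum by (simp add: P)
  have "q = (\<Sum>i=1..k. (\<Theta> i \<bullet> q) *\<^sub>R \<Theta> i)"
    unfolding q
    by (rule central_heat_flux_eigenvector_expansion[OF grp finite_atLeastAtMost orth
        Psum[unfolded P]])
  also have "\<dots> = (\<Sum>i=1..k. qh i *\<^sub>R \<Theta> i)" by (simp add: assms(10))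
  finally have heat: "central_heat_flux (2 * k) vt gt = central_heat_flux m v g"
    using red(4) by (simp add: q)
  have W: "total_weight m g \<noteq> 0" "total_weight (2 * k) gt \<noteq> 0"
    using \<rho>0 by (simp_all add: tw \<rho>)
  have "stochastic_group (2 * k) vt gt"
    unfolding stochastic_group_def
  proof
    fix i assume i: "i \<in> {1..2 * k}"
    show "0 < gt i"
    proof (cases "i \<le> k")
      case True
      then show ?thesis using pair(1)[of i] i by simp
    next
      case False
      then have "i - k \<in> {1..k}" using i by auto
      from pair(2)[OF this] show ?thesis using False by simp
    qed
  qed
  moreover have "momentum (2 * k) vt gt = momentum m v g"
    by (simp only: momentum_eq_weight_drift[OF W(1)] momentum_eq_weight_drift[OF W(2)] tw drift)
  moreover have "momentum_flux (2 * k) vt gt = momentum_flux m v g"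
    by (simp only: momentum_flux_eq_pressure_tensor[OF W(1)]
        momentum_flux_eq_pressure_tensor[OF W(2)] tw drift pressure)
  moreover have "raw_heat_flux (2 * k) vt gt = raw_heat_flux m v g"
    by (simp only: raw_heat_flux_eq_central[OF W(1)] raw_heat_flux_eq_central[OF W(2)]
        tw drift pressure heat)
  ultimately show ?thesis using tw pressure heat by blast
qed

end
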